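(* Let $G$ be an ordered group with neutral element $e$ and let $S$ be a nonzero nearly epsilon-strongly $G$-graded ring. Then $S$ is prime if and only if $S_e$ is $G$-prime.
   Context: A group $G$ is ordered if it is equipped with a total order relation $\leq$ such that for all $a,b,x,y\in G$, $a\leq b$ implies $xay\leq xby$. Rings are associative but not necessarily unital; ideals are two-sided. For subsets $U,V$ of a ring, $UV$ denotes the set of finite sums of elements $uv$ with $u\in U$, $v\in V$. A ring $S$ is prime if $\{0\}$ is a proper ideal and for all ideals $A,B$ of $S$, $AB=\{0\}$ implies $A=\{0\}$ or $B=\{0\}$. A ring $S$ is $G$-graded if $S=\bigoplus_{x\in G}S_x$ as additive groups for given additive subgroups $S_x$, with $S_xS_y\subseteq S_{xy}$ for all $x,y\in G$. $S$ is nearly epsilon-strongly $G$-graded if for every $x\in G$ and every $s\in S_x$ there exist $\epsilon_x(s)\in S_xS_{x^{-1}}$ and $\epsilon_x'(s)\in S_{x^{-1}}S_x$ such that $\epsilon_x(s)s=s=s\epsilon_x'(s)$. An ideal $I$ of $S_e$ is $G$-invariant if $S_{x^{-1}}IS_x\subseteq I$ for every $x\in G$. The ring $S_e$ is $G$-prime if $\{0\}$ is a proper ideal of $S_e$ and for all $G$-invariant ideals $A,B$ of $S_e$, $AB=\{0\}$ implies $A=\{0\}$ or $B=\{0\}$. *)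

theory Defs
  imports Main
begin

text \<open>Ordered groups, not necessarily commutative.  As with the library class
  \<^class>\<open>group_add\<close>, which does not assume commutativity, the group operation is written
  additively: \<open>x + y\<close>, \<open>- x\<close> and \<open>0\<close> stand for \<open>xy\<close>, the inverse of \<open>x\<close> and the neutral
  element \<open>e\<close>.\<close>

class ordered_group = group_add + linorder +
  assumes translate_mono: "a \<le> b \<Longrightarrow> x + a + y \<le> x + b + y"

text \<open>The ambient ring is a type of class \<^class>\<open>ring\<close> (associative, no unit assumed); a ring
  inside it is given by its carrier, a subset.\<close>

definition additive_subgroup :: "'a::ab_group_add set \<Rightarrow> bool" where
  "additive_subgroup H \<longleftrightarrow>
     0 \<in> H \<and> (\<forall>a\<in>H. \<forall>b\<in>H. a + b \<in> H) \<and> (\<forall>a\<in>H. - a \<in> H)"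

text \<open>The set of all finite sums of products (the empty sum included), not the elementwise
  product of sets.\<close>

definition sums_of_products :: "'a::ring set \<Rightarrow> 'a set \<Rightarrow> 'a set"  (infixl "\<odot>" 70) where
  "U \<odot> V = {(\<Sum>i<n. u i * v i) |(n::nat) u v. \<forall>i<n. u i \<in> U \<and> v i \<in> V}"

definition ideal_of :: "'a::ring set \<Rightarrow> 'a set \<Rightarrow> bool" where
  "ideal_of R I \<longleftrightarrow>
     I \<subseteq> R \<and> additive_subgroup I \<and> (\<forall>r\<in>R. \<forall>a\<in>I. r * a \<in> I \<and> a * r \<in> I)"

definition proper_ideal_of :: "'a::ring set \<Rightarrow> 'a set \<Rightarrow> bool" where
  "proper_ideal_of R I \<longleftrightarrow> ideal_of R I \<and> I \<noteq> R"

definition prime_ring :: "'a::ring set \<Rightarrow> bool" where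
  "prime_ring R \<longleftrightarrow>
     proper_ideal_of R {0} \<and>
     (\<forall>A B. ideal_of R A \<longrightarrow> ideal_of R B \<longrightarrow> A \<odot> B = {0} \<longrightarrow> A = {0} \<or> B = {0})"

text \<open>The unique existence of the finitely supported family of components says that the whole
  ring is the internal direct sum of the \<open>S x\<close>.\<close>

definition graded_ring :: "('g::group_add \<Rightarrow> 'a::ring set) \<Rightarrow> bool" where
  "graded_ring S \<longleftrightarrow>
     (\<forall>x. additive_subgroup (S x)) \<and>
     (\<forall>s. \<exists>!f. (\<forall>x. f x \<in> S x) \<and> finite {x. f x \<noteq> 0} \<and> s = (\<Sum>x | f x \<noteq> 0. f x)) \<and>
     (\<forall>x y. S x \<odot> S y \<subseteq> S (x + y))"

definition nearly_epsilon_strongly_graded :: "('g::group_add \<Rightarrow> 'a::ring set) \<Rightarrow> bool" where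
  "nearly_epsilon_strongly_graded S \<longleftrightarrow>
     graded_ring S \<and>
     (\<forall>x. \<forall>s\<in>S x. \<exists>\<epsilon>\<in>S x \<odot> S (- x). \<exists>\<epsilon>'\<in>S (- x) \<odot> S x. \<epsilon> * s = s \<and> s = s * \<epsilon>')"

definition G_invariant :: "('g::group_add \<Rightarrow> 'a::ring set) \<Rightarrow> 'a set \<Rightarrow> bool" where
  "G_invariant S I \<longleftrightarrow> (\<forall>x. S (- x) \<odot> I \<odot> S x \<subseteq> I)"

definition G_prime :: "('g::group_add \<Rightarrow> 'a::ring set) \<Rightarrow> bool" where
  "G_prime S \<longleftrightarrow>
     proper_ideal_of (S 0) {0} \<and>
     (\<forall>A B. ideal_of (S 0) A \<and> G_invariant S A \<longrightarrow> ideal_of (S 0) B \<and> G_invariant S B \<longrightarrow>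
        A \<odot> B = {0} \<longrightarrow> A = {0} \<or> B = {0})"

end

theory Submission
  imports Defs
begin

text \<open>Write \<open>S\<^sub>x\<close> for the components.  If \<open>A\<close>, \<open>B\<close> are invariant ideals of \<open>S\<^sub>e\<close> with \<open>AB = 0\<close>, then
  for \<open>a \<in> A\<close>, \<open>s \<in> S\<^sub>x\<close> the local unit \<open>\<Sum> u\<^sub>i v\<^sub>i\<close> of \<open>as\<close> gives \<open>as = \<Sum> u\<^sub>i (v\<^sub>i a s)\<close> with \<open>v\<^sub>i a s \<in> A\<close>,
  so \<open>A S B = 0\<close>, and the ideals of \<open>S\<close> generated by \<open>A\<close> and \<open>B\<close> annihilate each other.
  Conversely, the leading coefficients at \<open>e\<close> of the elements of degree at most \<open>e\<close> in an ideal
  \<open>I\<close> of \<open>S\<close> form an invariant ideal of \<open>S\<^sub>e\<close>; it is nonzero when \<open>I\<close> is, because local units move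
  a leading coefficient of any degree to degree \<open>e\<close>; and leading coefficients of \<open>A\<close> and \<open>B\<close>
  annihilate each other when \<open>AB = 0\<close>.\<close>

section \<open>Testing finite sums of products on single products\<close>

lemma additive_subgroup_sum:
  assumes "additive_subgroup H" and "\<And>i. i \<in> F \<Longrightarrow> f i \<in> H"
  shows "sum f F \<in> H"
  using assms(2)
  by (induction F rule: infinite_finite_induct)
    (use assms(1) in \<open>auto simp: additive_subgroup_def\<close>)

lemma product_in_sums_of_products: "u \<in> U \<Longrightarrow> v \<in> V \<Longrightarrow> u * v \<in> U \<odot> V"
  unfolding sums_of_products_def
  by (rule CollectI, rule exI[of _ 1], rule exI[of _ "\<lambda>_. u"], rule exI[of _ "\<lambda>_. v"]) simp

text \<open>An additive subgroup absorbs finite sums. Taking annihilators such as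
  \<open>{w. w * c = 0}\<close> for \<open>H\<close> then carries a property from single products
  over to a local unit.\<close>

lemma sums_of_products_subset_iff:
  assumes "additive_subgroup H"
  shows "U \<odot> V \<subseteq> H \<longleftrightarrow> (\<forall>u\<in>U. \<forall>v\<in>V. u * v \<in> H)"
proof
  show "U \<odot> V \<subseteq> H" if "\<forall>u\<in>U. \<forall>v\<in>V. u * v \<in> H"
    using that unfolding sums_of_products_def by (auto intro!: additive_subgroup_sum[OF assms])
qed (use product_in_sums_of_products in blast)

lemma additive_subgroup_zero: "additive_subgroup {0}"
  by (simp add: additive_subgroup_def)

text \<open>The empty sum puts \<open>0\<close> into \<open>U \<odot> V\<close>, even for empty
  \<open>U\<close> or \<open>V\<close>, so equality with \<open>{0}\<close> amounts to
  inclusion.\<close>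

lemma sums_of_products_eq_zero_iff: "U \<odot> V = {0} \<longleftrightarrow> (\<forall>u\<in>U. \<forall>v\<in>V. u * v = 0)"
proof -
  have "0 \<in> U \<odot> V"
    unfolding sums_of_products_def by (rule CollectI, rule exI[of _ 0]) simp
  then have "U \<odot> V = {0} \<longleftrightarrow> U \<odot> V \<subseteq> {0}"
    by auto
  then show ?thesis
    by (simp add: sums_of_products_subset_iff[OF additive_subgroup_zero])
qed

lemma G_invariant_iff:
  assumes "additive_subgroup I"
  shows "G_invariant S I \<longleftrightarrow> (\<forall>x. \<forall>s\<in>S (- x). \<forall>a\<in>I. \<forall>t\<in>S x. s * a * t \<in> I)"
proof -
  have "(\<forall>w\<in>U \<odot> I. w * t \<in> I) \<longleftrightarrow> (\<forall>s\<in>U. \<forall>a\<in>I. s * a * t \<in> I)" for U t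
  proof -
    \<comment> \<open>With \<open>t\<close> fixed, the inner sums of products are removed by the
      same criterion, applied to the preimage of \<open>I\<close> under right multiplication by
      \<open>t\<close>.\<close>
    have "additive_subgroup {w. w * t \<in> I}"
      using assms by (auto simp: additive_subgroup_def distrib_right)
    from sums_of_products_subset_iff[OF this, of U I] show ?thesis
      by (simp add: subset_iff Ball_def)
  qed
  then show ?thesis
    unfolding G_invariant_def sums_of_products_subset_iff[OF assms] by blast
qed

section \<open>Homogeneous elements and local units\<close>

lemma graded_ring_component: "graded_ring S \<Longrightarrow> additive_subgroup (S x)"
  by (simp add: graded_ring_def)

lemma graded_ring_mult:
  "graded_ring S \<Longrightarrow> a \<in> S x \<Longrightarrow> b \<in> S y \<Longrightarrow> a * b \<in> S (x + y)"
  unfolding graded_ring_def using product_in_sums_of_products by blast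

lemma graded_ring_decomposition:
  assumes "graded_ring S"
  obtains f where "\<And>x. f x \<in> S x" "finite {x. f x \<noteq> 0}" "s = (\<Sum>x | f x \<noteq> 0. f x)"
proof -
  have "\<forall>s. \<exists>!f. (\<forall>x. f x \<in> S x) \<and> finite {x. f x \<noteq> 0} \<and> s = (\<Sum>x | f x \<noteq> 0. f x)"
    using assms unfolding graded_ring_def by (elim conjE)
  then show ?thesis
    using that by (blast dest: spec[of _ s])
qed

lemma local_left_unit:
  assumes "nearly_epsilon_strongly_graded S" and "c \<in> S x"
  obtains \<epsilon> where "\<epsilon> \<in> S x \<odot> S (- x)" "\<epsilon> * c = c"
  using assms unfolding nearly_epsilon_strongly_graded_def by blast

text \<open>A local unit of a homogeneous element lies in \<open>S 0\<close>; if \<open>S 0\<close>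
  vanishes, so does every homogeneous element, and hence every sum of such elements.\<close>

lemma zero_if_neutral_component_zero:
  fixes S :: "'g::group_add \<Rightarrow> 'a::ring set"
  assumes "nearly_epsilon_strongly_graded S" and "S 0 = {0}"
  shows "s = (0::'a)"
proof -
  have gr: "graded_ring S"
    using assms by (simp add: nearly_epsilon_strongly_graded_def)
  have "c = 0" if c: "c \<in> S x" for x c
  proof -
    obtain \<epsilon> where \<epsilon>: "\<epsilon> \<in> S x \<odot> S (- x)" "\<epsilon> * c = c"
      using local_left_unit[of S c x] assms(1) c by blast
    moreover have "S x \<odot> S (- x) \<subseteq> S 0"
      using gr unfolding graded_ring_def by (metis add.right_inverse)
    ultimately show ?thesis
      using assms(2) by auto
  qed
  moreover obtain f where "\<And>x. f x \<in> S x" "s = (\<Sum>x | f x \<noteq> 0. f x)"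
    using graded_ring_decomposition[OF gr, of s] by blast
  ultimately show ?thesis
    by (metis (no_types, lifting) sum.neutral)
qed

text \<open>If every \<open>v\<close> in \<open>S (- x)\<close> killed \<open>c\<close>, so would
  every \<open>u * v\<close>, and with them the local unit that fixes \<open>c\<close>.\<close>

lemma homogeneous_nonzero_left_mult:
  assumes "nearly_epsilon_strongly_graded S" and "c \<in> S x" and "c \<noteq> 0"
  shows "\<exists>v\<in>S (- x). v * c \<noteq> 0"
proof (rule ccontr)
  assume *: "\<not> (\<exists>v\<in>S (- x). v * c \<noteq> 0)"
  obtain \<epsilon> where \<epsilon>: "\<epsilon> \<in> S x \<odot> S (- x)" "\<epsilon> * c = c"
    using local_left_unit[of S c x] assms by blast
  have "additive_subgroup {w. w * c = 0}"
    by (simp add: additive_subgroup_def distrib_right)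
  then have "S x \<odot> S (- x) \<subseteq> {w. w * c = 0}"
    using * by (simp add: sums_of_products_subset_iff mult.assoc)
  with \<epsilon> assms(3) show False
    by auto
qed

section \<open>From primeness of the ring to G-primeness of \<open>S 0\<close>\<close>

lemma invariant_annihilator:
  assumes S: "nearly_epsilon_strongly_graded S"
    and A: "ideal_of (S 0) A" "G_invariant S A"
    and AB: "\<And>a b. a \<in> A \<Longrightarrow> b \<in> B \<Longrightarrow> a * b = 0"
    and a: "a \<in> A" and b: "b \<in> B"
  shows "a * s * b = 0"
proof -
  have gr: "graded_ring S"
    using S by (simp add: nearly_epsilon_strongly_graded_def)
  have hom: "a * c * b = 0" if c: "c \<in> S x" for x c
  proof -
    have "a * c \<in> S x"
      using graded_ring_mult[OF gr, of a 0 c x] A(1) a c by (auto simp: ideal_of_def)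
    then obtain \<epsilon> where \<epsilon>: "\<epsilon> \<in> S x \<odot> S (- x)" "\<epsilon> * (a * c) = a * c"
      using local_left_unit[of S "a * c" x] S by blast
    have sub: "additive_subgroup {w. w * (a * c) * b = 0}"
      by (simp add: additive_subgroup_def distrib_right)
    \<comment> \<open>Invariance puts \<open>v * a * c\<close> into \<open>A\<close>, since the
      degrees of \<open>v\<close> and \<open>c\<close> are inverse to each other.\<close>
    have "v * a * c * b = 0" if v: "v \<in> S (- x)" for v
      using v A a b c AB G_invariant_iff[of A S] by (simp add: ideal_of_def)
    then have "u * v * (a * c) * b = 0" if "v \<in> S (- x)" for u v
      using that by (simp add: mult.assoc)
    then have "S x \<odot> S (- x) \<subseteq> {w. w * (a * c) * b = 0}"
      by (simp add: sums_of_products_subset_iff[OF sub])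
    then have "\<epsilon> * (a * c) * b = 0"
      using \<epsilon>(1) by blast
    then show ?thesis
      by (simp only: \<epsilon>(2))
  qed
  obtain f where f: "\<And>x. f x \<in> S x" "s = (\<Sum>x | f x \<noteq> 0. f x)"
    using graded_ring_decomposition[OF gr, of s] by blast
  have "(\<Sum>x | f x \<noteq> 0. a * f x * b) = 0"
    using hom f(1) by (blast intro: sum.neutral)
  then show ?thesis
    unfolding f(2) by (simp only: sum_distrib_left sum_distrib_right)
qed

lemma G_prime_if_prime_ring:
  fixes S :: "'g::group_add \<Rightarrow> 'a::ring set"
  assumes S: "nearly_epsilon_strongly_graded S" and prime: "prime_ring (UNIV :: 'a set)"
  shows "G_prime S"
  unfolding G_prime_def
proof (intro conjI allI impI)
  have gr: "graded_ring S"
    using S by (simp add: nearly_epsilon_strongly_graded_def)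
  have "(UNIV :: 'a set) \<noteq> {0}"
    using prime by (auto simp: prime_ring_def proper_ideal_of_def)
  then have "S 0 \<noteq> {0}"
    using zero_if_neutral_component_zero[OF S] by blast
  then show "proper_ideal_of (S 0) {0}"
    using graded_ring_component[OF gr, of 0]
    by (auto simp: proper_ideal_of_def ideal_of_def additive_subgroup_def)
  fix A B
  assume A: "ideal_of (S 0) A \<and> G_invariant S A"
    and B: "ideal_of (S 0) B \<and> G_invariant S B"
    and AB: "A \<odot> B = {0}"
  have ASB: "a * s * b = 0" if "a \<in> A" "b \<in> B" for a s b
    using invariant_annihilator[OF S, of A B] A AB that by (simp add: sums_of_products_eq_zero_iff)
  text \<open>Annihilators replace the generated ideals, which avoids computing with finite sums.\<close>
  define B' where "B' = {b. \<forall>a\<in>A. \<forall>s. a * s * b = 0}"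
  define A' where "A' = {a. \<forall>b\<in>B'. a * b = 0}"
  have B'_mult: "t * b \<in> B'" "b * t \<in> B'" if "b \<in> B'" for b t
  proof -
    \<comment> \<open>A factor on the left of \<open>b\<close> is absorbed by the arbitrary middle
      factor \<open>s\<close>, so \<open>B'\<close> is two-sided; this in turn makes
      \<open>A'\<close> two-sided.\<close>
    have "a * s * (t * b) = a * (s * t) * b" "a * s * (b * t) = a * s * b * t" for a s
      by (simp_all add: mult.assoc)
    then show "t * b \<in> B'" "b * t \<in> B'"
      using that by (simp_all add: B'_def)
  qed
  have "ideal_of UNIV B'"
    using B'_mult by (auto simp: ideal_of_def additive_subgroup_def B'_def distrib_left)
  moreover have "ideal_of UNIV A'"
    using B'_mult by (auto simp: ideal_of_def additive_subgroup_def A'_def distrib_right mult.assoc)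
  moreover have "A' \<odot> B' = {0}"
    by (simp add: sums_of_products_eq_zero_iff A'_def)
  ultimately have "A' = {0} \<or> B' = {0}"
    using prime by (simp add: prime_ring_def)
  moreover have "A \<subseteq> A'"
  proof
    fix a assume a: "a \<in> A"
    \<comment> \<open>The definition of \<open>B'\<close> has a factor between \<open>a\<close> and
      \<open>b\<close>. Without a unit in the ring, the right local unit of \<open>a\<close> fills
      that place.\<close>
    then obtain \<epsilon> where \<epsilon>: "a = a * \<epsilon>"
      using A S unfolding ideal_of_def nearly_epsilon_strongly_graded_def by blast
    have "a * b = 0" if "b \<in> B'" for b
    proof -
      have "a * \<epsilon> * b = 0"
        using that a by (simp add: B'_def)
      then show ?thesis
        by (simp only: \<epsilon>[symmetric])
    qed
    then show "a \<in> A'"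
      by (simp add: A'_def)
  qed
  moreover have "B \<subseteq> B'"
    using ASB by (auto simp: B'_def)
  moreover have "0 \<in> A" "0 \<in> B"
    using A B by (auto simp: ideal_of_def additive_subgroup_def)
  ultimately show "A = {0} \<or> B = {0}"
    by auto
qed

section \<open>Sums of terms below a given degree\<close>

text \<open>Degrees may repeat and terms may vanish, so closure properties follow by induction on
  the terms, without normalising to unique components.\<close>

inductive_set lower_part :: "('g::ordered_group \<Rightarrow> 'a::ring set) \<Rightarrow> 'g \<Rightarrow> 'a set"
  for S x where
  zero: "0 \<in> lower_part S x"
| add: "c \<in> S y \<Longrightarrow> y < x \<Longrightarrow> l \<in> lower_part S x \<Longrightarrow> c + l \<in> lower_part S x"

lemma ordered_group_add_strict_mono:
  fixes x y :: "'g::ordered_group"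
  shows "y < x \<Longrightarrow> a + y < a + x" and "y < x \<Longrightarrow> y + a < x + a"
  using translate_mono[of y x a 0] translate_mono[of y x 0 a] by (simp_all add: less_le)

lemma lower_part_homogeneous: "c \<in> S y \<Longrightarrow> y < x \<Longrightarrow> c \<in> lower_part S x"
  using lower_part.add[OF _ _ lower_part.zero] by fastforce

lemma lower_part_add: "l \<in> lower_part S x \<Longrightarrow> m \<in> lower_part S x \<Longrightarrow> l + m \<in> lower_part S x"
  by (induction rule: lower_part.induct) (auto simp: add.assoc intro: lower_part.add)

lemma additive_subgroup_lower_part:
  assumes "graded_ring S"
  shows "additive_subgroup (lower_part S x)"
proof -
  have "- l \<in> lower_part S x" if "l \<in> lower_part S x" for l
    using that
  proof (induction rule: lower_part.induct)
    case (add c y l)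
    then have "- c \<in> S y"
      using graded_ring_component[OF assms, of y] by (simp add: additive_subgroup_def)
    with add show ?case
      using lower_part.add[of "- c" S y x "- l"] by simp
  qed (simp add: lower_part.zero)
  then show ?thesis
    by (simp add: additive_subgroup_def lower_part.zero lower_part_add)
qed

lemma lower_part_mult_left:
  assumes "graded_ring S" and "c \<in> S y" and "l \<in> lower_part S x"
  shows "c * l \<in> lower_part S (y + x)"
  using assms(3)
proof (induction rule: lower_part.induct)
  case (add d z l)
  then show ?case
    using graded_ring_mult[OF assms(1,2), of d z] ordered_group_add_strict_mono(1)
    by (auto simp: distrib_left intro: lower_part.add)
qed (simp add: lower_part.zero)

lemma lower_part_mult_right:
  assumes "graded_ring S" and "c \<in> S y" and "l \<in> lower_part S x"
  shows "l * c \<in> lower_part S (x + y)"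
  using assms(3)
proof (induction rule: lower_part.induct)
  case (add d z l)
  then show ?case
    using graded_ring_mult[OF assms(1) _ assms(2), of d z] ordered_group_add_strict_mono(2)
    by (auto simp: distrib_right intro: lower_part.add)
qed (simp add: lower_part.zero)

lemma lower_part_mono: "l \<in> lower_part S y \<Longrightarrow> y \<le> x \<Longrightarrow> l \<in> lower_part S x"
  by (induction rule: lower_part.induct) (auto intro: lower_part.intros)

lemma lower_part_mult:
  assumes "graded_ring S" and "l \<in> lower_part S x" and "m \<in> lower_part S y"
  shows "l * m \<in> lower_part S (x + y)"
  using assms(2)
proof (induction rule: lower_part.induct)
  case (add d z l)
  \<comment> \<open>The product lies below \<open>z + y\<close>, which is itself below
    \<open>x + y\<close>.\<close>
  have "d * m \<in> lower_part S (x + y)"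
    using lower_part_mult_left[OF assms(1) add(1) assms(3)] ordered_group_add_strict_mono(2)[OF add(2), of y]
    by (auto intro: lower_part_mono)
  with add show ?case
    by (simp add: distrib_right lower_part_add)
qed (simp add: lower_part.zero)

text \<open>This links \<open>lower_part\<close> to the families in the definition of a grading, so
  that uniqueness of components can be applied.\<close>

lemma lower_part_family:
  assumes "graded_ring S" and "l \<in> lower_part S x"
  shows "\<exists>f. (\<forall>y. f y \<in> S y) \<and> finite {y. f y \<noteq> 0} \<and> f x = 0 \<and> l = (\<Sum>y | f y \<noteq> 0. f y)"
  using assms(2)
proof (induction rule: lower_part.induct)
  case zero
  have "\<forall>y. 0 \<in> S y"
    using graded_ring_component[OF assms(1)] by (simp add: additive_subgroup_def)
  then show ?case
    by (intro exI[of _ "\<lambda>_. 0"]) simp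
next
  case (add c y l)
  then obtain f where f: "\<forall>z. f z \<in> S z" "finite {z. f z \<noteq> 0}" "f x = 0"
    and l: "l = (\<Sum>z | f z \<noteq> 0. f z)"
    by blast
  \<comment> \<open>Degree \<open>y\<close> may already occur in \<open>f\<close>, so
    \<open>c\<close> is merged into that component.\<close>
  define g where "g = f(y := c + f y)"
  let ?F = "insert y {z. f z \<noteq> 0}"
  \<comment> \<open>Equality can fail because \<open>c + f y\<close> may cancel; the sums are
    therefore compared over \<open>?F\<close>.\<close>
  have supp: "{z. g z \<noteq> 0} \<subseteq> ?F"
    by (auto simp: g_def)
  have "(\<Sum>z | g z \<noteq> 0. g z) = sum g ?F"
    using supp f(2) by (intro sum.mono_neutral_left) auto
  also have "\<dots> = g y + sum g (?F - {y})"
    using f(2) by (intro sum.remove) auto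
  also have "sum g (?F - {y}) = sum f (?F - {y})"
    by (intro sum.cong) (auto simp: g_def)
  also have "g y + sum f (?F - {y}) = c + (f y + sum f (?F - {y}))"
    by (simp add: g_def add.assoc)
  also have "f y + sum f (?F - {y}) = sum f ?F"
    using f(2) by (intro sum.remove[symmetric]) auto
  also have "sum f ?F = l"
    unfolding l using f(2) by (intro sum.mono_neutral_right) auto
  finally have "c + l = (\<Sum>z | g z \<noteq> 0. g z)"
    by simp
  moreover have "\<forall>z. g z \<in> S z"
    using f(1) add(1) graded_ring_component[OF assms(1), of y]
    by (simp add: g_def additive_subgroup_def)
  moreover have "finite {z. g z \<noteq> 0}"
    using finite_subset[OF supp] f(2) by simp
  moreover have "g x = 0"
    using f(3) add(2) by (auto simp: g_def)
  ultimately show ?case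
    by blast
qed

text \<open>Otherwise \<open>c\<close> would have two families of components, one concentrated at
  \<open>x\<close> and one vanishing there.\<close>

lemma homogeneous_lower_part_zero:
  assumes gr: "graded_ring S" and c: "c \<in> S x" "c \<in> lower_part S x"
  shows "c = 0"
proof (rule ccontr)
  assume "c \<noteq> 0"
  define g where "g y = (if y = x then c else 0)" for y
  have supp: "{y. g y \<noteq> 0} = {x}"
    using \<open>c \<noteq> 0\<close> by (auto simp: g_def)
  have g: "(\<forall>y. g y \<in> S y) \<and> finite {y. g y \<noteq> 0} \<and> c = (\<Sum>y | g y \<noteq> 0. g y)"
    unfolding supp using c(1) graded_ring_component[OF gr] by (simp add: g_def additive_subgroup_def)
  obtain f where f: "(\<forall>y. f y \<in> S y) \<and> finite {y. f y \<noteq> 0} \<and> c = (\<Sum>y | f y \<noteq> 0. f y)" "f x = 0"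
    using lower_part_family[OF gr c(2)] by metis
  have "\<forall>s. \<exists>!f. (\<forall>y. f y \<in> S y) \<and> finite {y. f y \<noteq> 0} \<and> s = (\<Sum>y | f y \<noteq> 0. f y)"
    using gr unfolding graded_ring_def by (elim conjE)
  then have "f = g"
    using f(1) g by (blast dest: spec[of _ c])
  then show False
    using f(2) \<open>c \<noteq> 0\<close> by (simp add: g_def)
qed

text \<open>The leading term sits at the maximum of the finite support, which exists because the
  order is total.\<close>

lemma leading_decomposition:
  assumes "graded_ring S" and "s \<noteq> 0"
  obtains x c l where "c \<in> S x" "c \<noteq> 0" "l \<in> lower_part S x" "s = c + l"
proof -
  obtain f where f: "\<And>x. f x \<in> S x" "finite {x. f x \<noteq> 0}" "s = (\<Sum>x | f x \<noteq> 0. f x)"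
    using graded_ring_decomposition[OF assms(1), of s] by blast
  let ?F = "{x. f x \<noteq> 0}"
  have "?F \<noteq> {}"
    using assms(2) f(3) by (metis sum.empty)
  with f(2) have M: "Max ?F \<in> ?F"
    by (rule Max_in)
  have "y < Max ?F" if "y \<in> ?F - {Max ?F}" for y
    using that f(2) by (simp add: order.strict_iff_order)
  then have "sum f (?F - {Max ?F}) \<in> lower_part S (Max ?F)"
    using f(1) by (intro additive_subgroup_sum additive_subgroup_lower_part assms(1))
      (blast intro: lower_part_homogeneous)
  moreover have "s = f (Max ?F) + sum f (?F - {Max ?F})"
    unfolding f(3) using f(2) M by (rule sum.remove)
  ultimately show ?thesis
    using that f(1) M by blast
qed

section \<open>Leading coefficients at the neutral degree\<close>

text \<open>The coefficient \<open>c\<close> may be \<open>0\<close>, which keeps the set closed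
  under addition when leading terms cancel.\<close>

definition leading_ideal :: "('g::ordered_group \<Rightarrow> 'a::ring set) \<Rightarrow> 'a set \<Rightarrow> 'a set" where
  "leading_ideal S I = {c \<in> S 0. \<exists>l\<in>lower_part S 0. c + l \<in> I}"

lemma additive_subgroup_leading_ideal:
  assumes "graded_ring S" and "additive_subgroup I"
  shows "additive_subgroup (leading_ideal S I)"
proof -
  note subgroups = graded_ring_component[OF assms(1), of 0]
    additive_subgroup_lower_part[OF assms(1), of 0] assms(2)
  have "a + b \<in> leading_ideal S I" if ab: "a \<in> leading_ideal S I" "b \<in> leading_ideal S I" for a b
  proof -
    obtain l m where "l \<in> lower_part S 0" "a + l \<in> I" "m \<in> lower_part S 0" "b + m \<in> I"
      using ab by (auto simp: leading_ideal_def)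
    moreover have "a + b + (l + m) = (a + l) + (b + m)"
      by (simp add: ac_simps)
    ultimately show ?thesis
      using ab subgroups unfolding leading_ideal_def additive_subgroup_def
      by (metis (mono_tags, lifting) mem_Collect_eq)
  qed
  moreover have "- a \<in> leading_ideal S I" if a: "a \<in> leading_ideal S I" for a
  proof -
    obtain l where "l \<in> lower_part S 0" "a + l \<in> I"
      using a by (auto simp: leading_ideal_def)
    moreover have "- a + - l = - (a + l)"
      by simp
    ultimately show ?thesis
      using a subgroups unfolding leading_ideal_def additive_subgroup_def
      by (metis (mono_tags, lifting) mem_Collect_eq)
  qed
  moreover have "0 \<in> leading_ideal S I"
    using subgroups by (force simp: leading_ideal_def additive_subgroup_def)
  ultimately show ?thesis
    by (simp add: additive_subgroup_def)
qed

lemma leading_ideal_ideal: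
  assumes gr: "graded_ring S" and I: "ideal_of UNIV I"
  shows "ideal_of (S 0) (leading_ideal S I)"
proof -
  have "r * a \<in> leading_ideal S I" "a * r \<in> leading_ideal S I"
    if r: "r \<in> S 0" and a: "a \<in> leading_ideal S I" for r a
  proof -
    obtain l where l: "l \<in> lower_part S 0" "a + l \<in> I" and a0: "a \<in> S 0"
      using a by (auto simp: leading_ideal_def)
    have "r * (a + l) \<in> I" "(a + l) * r \<in> I"
      using I l(2) by (auto simp: ideal_of_def)
    then show "r * a \<in> leading_ideal S I" "a * r \<in> leading_ideal S I"
      using graded_ring_mult[OF gr r a0] graded_ring_mult[OF gr a0 r]
        lower_part_mult_left[OF gr r l(1)] lower_part_mult_right[OF gr r l(1)]
      by (auto simp: leading_ideal_def distrib_left distrib_right)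
  qed
  moreover have "additive_subgroup (leading_ideal S I)"
    using additive_subgroup_leading_ideal[OF gr] I by (simp add: ideal_of_def)
  ultimately show ?thesis
    by (auto simp: ideal_of_def leading_ideal_def)
qed

text \<open>Multiplying by \<open>s\<close> and \<open>t\<close> shifts degrees by
  \<open>- x\<close> on the left and \<open>x\<close> on the right: degree \<open>0\<close> is kept,
  and strictly lower terms stay strictly lower.\<close>

lemma leading_ideal_invariant:
  assumes gr: "graded_ring S" and I: "ideal_of UNIV I"
  shows "G_invariant S (leading_ideal S I)"
proof -
  have "s * a * t \<in> leading_ideal S I"
    if s: "s \<in> S (- x)" and a: "a \<in> leading_ideal S I" and t: "t \<in> S x" for x s a t
  proof -
    obtain l where l: "l \<in> lower_part S 0" "a + l \<in> I" and a0: "a \<in> S 0"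
      using a by (auto simp: leading_ideal_def)
    have "s * (a + l) * t \<in> I"
      using I l(2) by (auto simp: ideal_of_def)
    then show ?thesis
      using graded_ring_mult[OF gr graded_ring_mult[OF gr s a0] t]
        lower_part_mult_right[OF gr t lower_part_mult_left[OF gr s l(1)]]
      by (auto simp: leading_ideal_def distrib_left distrib_right)
  qed
  then show ?thesis
    using additive_subgroup_leading_ideal[OF gr] I by (subst G_invariant_iff) (auto simp: ideal_of_def)
qed

lemma leading_ideal_eq_zero:
  assumes S: "nearly_epsilon_strongly_graded S" and I: "ideal_of UNIV I"
    and zero: "leading_ideal S I = {0}"
  shows "I = {0}"
proof (rule ccontr)
  have gr: "graded_ring S"
    using S by (simp add: nearly_epsilon_strongly_graded_def)
  assume "I \<noteq> {0}"
  moreover have "0 \<in> I"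
    using I by (simp add: ideal_of_def additive_subgroup_def)
  ultimately obtain s where "s \<in> I" "s \<noteq> 0"
    by auto
  obtain x c l where c: "c \<in> S x" "c \<noteq> 0" and l: "l \<in> lower_part S x" and s: "s = c + l"
    using leading_decomposition[OF gr \<open>s \<noteq> 0\<close>] by blast
  \<comment> \<open>Multiplication by \<open>v\<close> moves the leading term from degree
    \<open>x\<close> to degree \<open>0\<close> without killing it.\<close>
  obtain v where v: "v \<in> S (- x)" "v * c \<noteq> 0"
    using homogeneous_nonzero_left_mult[OF S c] by blast
  have "v * c + v * l \<in> I"
    using I \<open>s \<in> I\<close> by (simp add: ideal_of_def s flip: distrib_left)
  then have "v * c \<in> leading_ideal S I"
    using graded_ring_mult[OF gr v(1) c(1)] lower_part_mult_left[OF gr v(1) l]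
    by (auto simp: leading_ideal_def)
  with zero v(2) show False
    by simp
qed

text \<open>Expanding \<open>(a + l) * (b + m) = 0\<close> writes \<open>a * b\<close>, of degree
  \<open>0\<close>, as a sum of terms of negative degree, so directness of the grading forces it to
  vanish.\<close>

lemma leading_ideal_mult_zero:
  assumes gr: "graded_ring S" and AB: "\<And>a b. a \<in> A \<Longrightarrow> b \<in> B \<Longrightarrow> a * b = 0"
    and a: "a \<in> leading_ideal S A" and b: "b \<in> leading_ideal S B"
  shows "a * b = 0"
proof (rule homogeneous_lower_part_zero[OF gr])
  obtain l m where l: "l \<in> lower_part S 0" "a + l \<in> A" and m: "m \<in> lower_part S 0" "b + m \<in> B"
    and S0: "a \<in> S 0" "b \<in> S 0"
    using a b by (auto simp: leading_ideal_def)
  show "a * b \<in> S 0"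
    using graded_ring_mult[OF gr S0] by simp
  have "a * m + (l * b + l * m) \<in> lower_part S 0"
    using lower_part_mult_left[OF gr S0(1) m(1)] lower_part_mult_right[OF gr S0(2) l(1)]
      lower_part_mult[OF gr l(1) m(1)] by (simp add: lower_part_add)
  moreover have "a * b + (a * m + (l * b + l * m)) = 0"
    using AB[OF l(2) m(2)] by (simp add: distrib_left distrib_right ac_simps)
  then have "a * b = - (a * m + (l * b + l * m))"
    by (simp only: eq_neg_iff_add_eq_0)
  ultimately show "a * b \<in> lower_part S 0"
    using additive_subgroup_lower_part[OF gr, of 0] by (metis additive_subgroup_def)
qed

section \<open>From G-primeness of \<open>S 0\<close> to primeness of the ring\<close>

lemma prime_ring_if_G_prime:
  fixes S :: "'g::ordered_group \<Rightarrow> 'a::ring set"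
  assumes nontrivial: "(UNIV :: 'a set) \<noteq> {0}"
    and S: "nearly_epsilon_strongly_graded S" and prime: "G_prime S"
  shows "prime_ring (UNIV :: 'a set)"
  unfolding prime_ring_def
proof (intro conjI allI impI)
  have gr: "graded_ring S"
    using S by (simp add: nearly_epsilon_strongly_graded_def)
  show "proper_ideal_of UNIV {0 :: 'a}"
    using nontrivial by (auto simp: proper_ideal_of_def ideal_of_def additive_subgroup_def)
  fix A B :: "'a set"
  assume A: "ideal_of UNIV A" and B: "ideal_of UNIV B" and AB: "A \<odot> B = {0}"
  have "leading_ideal S A \<odot> leading_ideal S B = {0}"
    using leading_ideal_mult_zero[OF gr, of A B] AB by (simp add: sums_of_products_eq_zero_iff)
  then have "leading_ideal S A = {0} \<or> leading_ideal S B = {0}"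
    using prime leading_ideal_ideal[OF gr] leading_ideal_invariant[OF gr] A B
    by (simp add: G_prime_def)
  then show "A = {0} \<or> B = {0}"
    using leading_ideal_eq_zero[OF S] A B by blast
qed

theorem corollary4p14:
  fixes S :: "'g::ordered_group \<Rightarrow> 'a::ring set"
  assumes "(UNIV :: 'a set) \<noteq> {0}"
    and "nearly_epsilon_strongly_graded S"
  shows "prime_ring (UNIV :: 'a set) \<longleftrightarrow> G_prime S"
  using assms G_prime_if_prime_ring prime_ring_if_G_prime by blast

end
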